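(* Let $A=\{0=a_0<a_1<\cdots<a_\ell<a_{\ell+1}=m\}$ be a finite set of integers with $\gcd(A)=1$ and $|A|=\ell+2\geq 4$, and let $t\geq 1$ be an integer. Then for every integer $$h \geq \left\lfloor\frac{\mathrm{Fr}_t(A)+m}{a_1}\right\rfloor + \left\lfloor\frac{\mathrm{Fr}_t(m-A)+m}{m-a_{\ell}}\right\rfloor$$ one has $$(hA)^{(t)} = [hm]\setminus\big(\mathcal{E}_t(A)\cup (hm-\mathcal{E}_t(m-A))\big).$$
   Context: For an integer $N\ge 0$, $[N]:=\{0,1,\ldots,N\}$. For a set $X$ of integers and an integer $N$, $N-X:=\{N-x : x\in X\}$. For a finite set $A=\{0=a_0<a_1<\cdots<a_{\ell+1}=m\}$ of integers with $\gcd(A)=1$, an integer $h\geq 1$ and an integer $n$, let $r_{A,h}(n)$ be the number of $(k_0,\ldots,k_{\ell+1})\in\mathbb{Z}_{\geq 0}^{\ell+2}$ with $\sum_{i=0}^{\ell+1} k_i a_i=n$ and $\sum_{i=0}^{\ell+1}k_i=h$. For an integer $t\ge1$ let $(hA)^{(t)}:=\{n\in\mathbb{Z}_{\geq 0} : r_{A,h}(n)\geq t\}$, $\mathcal{P}_t(A):=\bigcup_{h\geq 1}(hA)^{(t)}$, $\mathcal{E}_t(A):=\mathbb{Z}_{\geq 0}\setminus\mathcal{P}_t(A)$ (a finite set), and $\mathrm{Fr}_t(A):=\max \mathcal{E}_t(A)$, with $\mathrm{Fr}_t(A):=0$ if $\mathcal{E}_t(A)=\varnothing$. The same definitions are applied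 to the set $m-A$, which also has minimum $0$, maximum $m$ and gcd $1$. *)

theory Defs
  imports Complex_Main "HOL-Library.FuncSet"
begin

text \<open>
  A tuple \<open>(k\<^sub>0, \<dots>, k\<^bsub>l+1\<^esub>)\<close> of non-negative integers is encoded as an extensional function
  on \<open>A\<close> itself, the coefficient \<open>k\<^sub>i\<close> of \<open>a\<^sub>i\<close> being the value at \<open>a\<^sub>i\<close>. For finite \<open>A\<close> the set
  below is finite, because the coefficients sum to \<open>h\<close>, so \<^const>\<open>card\<close> is a genuine count.
\<close>

definition rep_count :: "int set \<Rightarrow> nat \<Rightarrow> int \<Rightarrow> nat" where
  "rep_count A h n =
     card {k \<in> A \<rightarrow>\<^sub>E (UNIV :: nat set). (\<Sum>a\<in>A. int (k a) * a) = n \<and> (\<Sum>a\<in>A. k a) = h}"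

definition fold_sumset :: "nat \<Rightarrow> nat \<Rightarrow> int set \<Rightarrow> int set" where
  "fold_sumset t h A = {n. n \<ge> 0 \<and> rep_count A h n \<ge> t}"

definition representable :: "nat \<Rightarrow> int set \<Rightarrow> int set" where
  "representable t A = (\<Union>h\<in>{1..}. fold_sumset t h A)"

definition exceptional :: "nat \<Rightarrow> int set \<Rightarrow> int set" where
  "exceptional t A = {0..} - representable t A"

text \<open>
  \<^const>\<open>Max\<close> is meaningful here only when the exceptional set is finite. This holds for a finite
  set \<open>A\<close> of non-negative integers with \<open>0 \<in> A\<close>, \<open>Gcd A = 1\<close> and at least three elements. (For
  \<open>A = {0, 1}\<close> and \<open>t \<ge> 2\<close> it fails.)
\<close>

definition Frob :: "nat \<Rightarrow> int set \<Rightarrow> int" where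
  "Frob t A = (if exceptional t A = {} then 0 else Max (exceptional t A))"

end

theory Submission
  imports Defs
begin

text \<open>
  Since \<open>0 \<in> A\<close>, a representation may be padded with zeros, so \<^term>\<open>rep_count A h n\<close> grows with
  \<open>h\<close> and is constant once \<open>h\<close> reaches the largest number of nonzero summands that \<open>n\<close> admits,
  which is at most \<open>n / b\<close> for the least positive element \<open>b\<close> of \<open>A\<close>.  Hence membership of \<open>n\<close> in
  the union over all \<open>h\<close> can only fail to be visible at a given \<open>h\<close> if \<open>n\<close> is large.

  Write \<open>F\<close> for the largest exceptional number of \<open>A\<close> and \<open>s = (F + m) div b\<close>.  Every
  non-exceptional \<open>n \<le> F + m\<close> has at least \<open>t\<close> representations with \<open>s\<close> summands.  A larger \<open>n\<close>
  is brought into the window \<open>F < n \<le> F + m\<close>, in which no exceptional number lies, by removing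
  copies of \<open>m\<close>.  So \<open>h\<close> summands suffice for all non-exceptional \<open>n \<le> F + (h - s + 1) m\<close>
  (\<open>rep_count_ge_below\<close>).

  The reflection \<open>x \<mapsto> m - x\<close> of \<open>A\<close> turns representations of \<open>n\<close> by \<open>h\<close> summands into those of
  \<open>h m - n\<close> (\<open>rep_count_reflect\<close>).  With \<open>F'\<close> and \<open>s'\<close> for the reflected set, only numbers with
  \<open>n > F + (h - s + 1) m\<close> and \<open>h m - n > F' + (h - s' + 1) m\<close> escape both arguments.  Adding
  the two inequalities gives \<open>h m > (2 h - s - s' + 2) m\<close>, which is impossible for \<open>h \<ge> s + s'\<close>.

  All of this needs the exceptional set to be finite, so that its \<^const>\<open>Max\<close> is a true maximum
  (\<open>finite_exceptional\<close>).  That follows from Bezout's identity together with the exchange of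
  \<open>m\<close> copies of \<open>b\<close> for \<open>b\<close> copies of \<open>m\<close>, which produces as many representations as desired.
\<close>

section \<open>Counting representations\<close>

definition reps :: "int set \<Rightarrow> nat \<Rightarrow> int \<Rightarrow> (int \<Rightarrow> nat) set" where
  "reps A h n = {k \<in> A \<rightarrow>\<^sub>E UNIV. (\<Sum>a\<in>A. int (k a) * a) = n \<and> (\<Sum>a\<in>A. k a) = h}"

lemma rep_count_eq: "rep_count A h n = card (reps A h n)"
  by (simp add: rep_count_def reps_def)

lemma finite_reps:
  assumes "finite A"
  shows "finite (reps A h n)"
proof (rule finite_subset)
  show "reps A h n \<subseteq> A \<rightarrow>\<^sub>E {..h}"
    using assms by (auto simp: reps_def PiE_iff extensional_def intro: member_le_sum)
  show "finite (A \<rightarrow>\<^sub>E {..h})"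
    using assms by (simp add: finite_PiE)
qed

lemma sum_weight_update:
  fixes k :: "int \<Rightarrow> nat"
  assumes "finite A" "x \<in> A"
  shows "(\<Sum>a\<in>A. int ((k(x := v)) a) * a) = (\<Sum>a\<in>A - {x}. int (k a) * a) + int v * x"
    and "(\<Sum>a\<in>A. (k(x := v)) a) = (\<Sum>a\<in>A - {x}. k a) + v"
proof -
  have "(\<Sum>a\<in>A - {x}. int ((k(x := v)) a) * a) = (\<Sum>a\<in>A - {x}. int (k a) * a)"
    "(\<Sum>a\<in>A - {x}. (k(x := v)) a) = (\<Sum>a\<in>A - {x}. k a)"
    by (auto intro: sum.cong)
  then show "(\<Sum>a\<in>A. int ((k(x := v)) a) * a) = (\<Sum>a\<in>A - {x}. int (k a) * a) + int v * x"
    and "(\<Sum>a\<in>A. (k(x := v)) a) = (\<Sum>a\<in>A - {x}. k a) + v"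
    using sum.remove[OF assms, of "\<lambda>a. int ((k(x := v)) a) * a"]
      sum.remove[OF assms, of "k(x := v)"] by simp_all
qed

lemma update_mem_PiE:
  assumes "k \<in> A \<rightarrow>\<^sub>E (UNIV :: nat set)" "x \<in> A"
  shows "k(x := v) \<in> A \<rightarrow>\<^sub>E UNIV"
  using PiE_fun_upd[of v "\<lambda>_. UNIV" x k A] assms by (simp add: insert_absorb)

text \<open>
  Appending \<open>j\<close> copies of \<open>x\<close> is injective.  For \<open>x = 0\<close> this is monotonicity in the number of
  summands; for \<open>x = m\<close> it transports representations along an arithmetic progression.
\<close>

lemma rep_count_append:
  assumes "finite A" "x \<in> A"
  shows "rep_count A h n \<le> rep_count A (h + j) (n + int j * x)"
  unfolding rep_count_eq
proof (rule card_inj_on_le[where f = "\<lambda>k. k(x := k x + j)"])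
  show "inj_on (\<lambda>k. k(x := k x + j)) (reps A h n)"
  proof (rule inj_onI)
    fix k k' :: "int \<Rightarrow> nat"
    assume "k(x := k x + j) = k'(x := k' x + j)"
    then have "(k(x := k x + j)) y = (k'(x := k' x + j)) y" for y
      by simp
    then show "k = k'"
      by (metis add_right_cancel ext fun_upd_apply)
  qed
  show "(\<lambda>k. k(x := k x + j)) ` reps A h n \<subseteq> reps A (h + j) (n + int j * x)"
  proof safe
    fix k assume k: "k \<in> reps A h n"
    have "k(x := k x) \<in> reps A h n" using k by simp
    then have "(\<Sum>a\<in>A - {x}. int (k a) * a) + int (k x) * x = n"
      "(\<Sum>a\<in>A - {x}. k a) + k x = h"
      using sum_weight_update[OF assms, of k "k x"] by (simp_all add: reps_def)
    then show "k(x := k x + j) \<in> reps A (h + j) (n + int j * x)"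
      using k update_mem_PiE[OF _ assms(2)] sum_weight_update[OF assms, of k "k x + j"]
      by (simp add: reps_def algebra_simps del: fun_upd_apply)
  qed
qed (use assms finite_reps in blast)

lemma rep_count_mono:
  assumes "finite A" "0 \<in> A" "h \<le> h'"
  shows "rep_count A h n \<le> rep_count A h' n"
  using rep_count_append[OF assms(1,2), of h n "h' - h"] assms(3) by simp

text \<open>
  A sum \<open>n \<le> N\<close> of nonzero elements that are all at least \<open>b\<close> has at most \<open>N div b\<close> terms, so
  the number of zeros in a representation can be readjusted to give \<open>N div b\<close> summands in all.
  The nonzero part and the total determine the number of zeros, so this loses no information.
\<close>

lemma rep_count_saturates:
  fixes b N :: int
  assumes "finite A" "0 \<in> A" "b > 0" "\<And>x. x \<in> A \<Longrightarrow> x \<noteq> 0 \<Longrightarrow> b \<le> x" "n \<le> N" "0 \<le> N"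
  shows "rep_count A H n \<le> rep_count A (nat (N div b)) n"
  unfolding rep_count_eq
proof (rule card_inj_on_le[where f = "\<lambda>k. k(0 := nat (N div b) - (\<Sum>a\<in>A - {0}. k a))"])
  let ?f = "\<lambda>k. k(0 := nat (N div b) - (\<Sum>a\<in>A - {0}. k a))"
  have split: "(\<Sum>a\<in>A - {0}. int (k a) * a) = n \<and> (\<Sum>a\<in>A - {0}. k a) + k 0 = H"
    if "k \<in> reps A H n" for k
    using that sum_weight_update[OF assms(1,2), of k "k 0"] by (simp add: reps_def)
  show "inj_on ?f (reps A H n)"
  proof (rule inj_onI)
    fix k k' assume k: "k \<in> reps A H n" and k': "k' \<in> reps A H n" and eq: "?f k = ?f k'"
    have off: "k a = k' a" if "a \<noteq> 0" for a
      using fun_cong[OF eq, of a] that by simp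
    then have "(\<Sum>a\<in>A - {0}. k a) = (\<Sum>a\<in>A - {0}. k' a)"
      by (intro sum.cong) auto
    then have "k 0 = k' 0"
      using split[OF k] split[OF k'] by linarith
    with off show "k = k'" by (metis ext)
  qed
  show "?f ` reps A H n \<subseteq> reps A (nat (N div b)) n"
  proof safe
    fix k assume k: "k \<in> reps A H n"
    have "int (\<Sum>a\<in>A - {0}. k a) * b = (\<Sum>a\<in>A - {0}. int (k a) * b)"
      by (simp add: sum_distrib_right)
    also have "\<dots> \<le> (\<Sum>a\<in>A - {0}. int (k a) * a)"
      using assms(4) by (intro sum_mono mult_left_mono) auto
    also have "\<dots> \<le> N"
      using split[OF k] assms(5) by simp
    finally have "int (\<Sum>a\<in>A - {0}. k a) * b div b \<le> N div b"
      using \<open>b > 0\<close> by (intro zdiv_mono1)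
    then have "int (\<Sum>a\<in>A - {0}. k a) \<le> N div b"
      using \<open>b > 0\<close> by simp
    then have "(\<Sum>a\<in>A - {0}. k a) \<le> nat (N div b)"
      by linarith
    then show "?f k \<in> reps A (nat (N div b)) n"
      using k split[OF k] sum_weight_update[OF assms(1,2), of k] update_mem_PiE[OF _ assms(2)]
      by (simp add: reps_def del: fun_upd_apply)
  qed
qed (use assms finite_reps in blast)

lemma reflect_image_image: "(\<lambda>x. m - x) ` (\<lambda>x. m - x) ` A = (A :: int set)"
  by (simp add: image_image)

text \<open>
  Transport of coefficients along \<open>x \<mapsto> m - x\<close> gives one inequality; as the reflection is an
  involution, the other one is the same statement for the reflected set.
\<close>

lemma rep_count_reflect_le:
  assumes "finite A"
  shows "rep_count A h n \<le> rep_count ((\<lambda>x. m - x) ` A) h (int h * m - n)"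
  unfolding rep_count_eq
proof (rule card_inj_on_le[where f = "\<lambda>k. \<lambda>y\<in>(\<lambda>x. m - x) ` A. k (m - y)"])
  let ?f = "\<lambda>k :: int \<Rightarrow> nat. \<lambda>y\<in>(\<lambda>x. m - x) ` A. k (m - y)"
  have f_eq: "?f k (m - x) = k x" if "x \<in> A" for k x
    using that by auto
  show "inj_on ?f (reps A h n)"
  proof (rule inj_onI)
    fix k k' assume k: "k \<in> reps A h n" and k': "k' \<in> reps A h n" and eq: "?f k = ?f k'"
    have "k x = k' x" if "x \<in> A" for x
      using f_eq[OF that, of k] f_eq[OF that, of k'] eq by simp
    then show "k = k'"
      using k k' by (auto simp: reps_def intro: PiE_ext)
  qed
  show "?f ` reps A h n \<subseteq> reps ((\<lambda>x. m - x) ` A) h (int h * m - n)"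
  proof safe
    fix k assume k: "k \<in> reps A h n"
    have inj: "inj_on (\<lambda>x. m - x) A"
      by (simp add: inj_on_def)
    have cnt: "(\<Sum>y\<in>(\<lambda>x. m - x) ` A. ?f k y) = h"
      using k by (simp add: sum.reindex[OF inj] reps_def cong: sum.cong)
    have "(\<Sum>y\<in>(\<lambda>x. m - x) ` A. int (?f k y) * y) = (\<Sum>x\<in>A. int (k x) * (m - x))"
      by (simp add: sum.reindex[OF inj] cong: sum.cong)
    also have "\<dots> = int (\<Sum>x\<in>A. k x) * m - (\<Sum>x\<in>A. int (k x) * x)"
      by (simp add: right_diff_distrib sum_subtractf sum_distrib_right)
    finally show "?f k \<in> reps ((\<lambda>x. m - x) ` A) h (int h * m - n)"
      using k cnt by (simp add: reps_def del: of_nat_sum restrict_apply)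
  qed
qed (use assms finite_reps in blast)

lemma rep_count_reflect:
  assumes "finite A"
  shows "rep_count ((\<lambda>x. m - x) ` A) h (int h * m - n) = rep_count A h n"
proof (rule antisym)
  show "rep_count ((\<lambda>x. m - x) ` A) h (int h * m - n) \<le> rep_count A h n"
    using rep_count_reflect_le[of "(\<lambda>x. m - x) ` A" h "int h * m - n" m] assms
    by (simp add: reflect_image_image)
qed (rule rep_count_reflect_le[OF assms])

lemma rep_count_pos_bounds:
  assumes "A \<subseteq> {0..m}" "rep_count A h n \<ge> 1"
  shows "0 \<le> n" "n \<le> int h * m"
proof -
  from assms(2) have "reps A h n \<noteq> {}"
    by (auto simp: rep_count_eq)
  then obtain k where k: "(\<Sum>a\<in>A. int (k a) * a) = n" "(\<Sum>a\<in>A. k a) = h"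
    by (auto simp: reps_def)
  show "0 \<le> n"
    using assms(1) by (auto simp flip: k(1) intro!: sum_nonneg)
  have "n \<le> (\<Sum>a\<in>A. int (k a) * m)"
    using assms(1) by (auto simp flip: k(1) intro!: sum_mono mult_left_mono)
  also have "\<dots> = int h * m"
    by (simp add: sum_distrib_right flip: k(2))
  finally show "n \<le> int h * m" .
qed

section \<open>Finiteness of the exceptional set\<close>

lemma Gcd_int_bezout:
  fixes A :: "int set"
  assumes "finite A"
  shows "\<exists>c. (\<Sum>x\<in>A. c x * x) = Gcd A"
  using assms
proof (induction A rule: finite_induct)
  case (insert y A)
  then obtain c where c: "(\<Sum>x\<in>A. c x * x) = Gcd A" by blast
  obtain u v where uv: "u * y + v * Gcd A = gcd y (Gcd A)"
    using bezout_int by blast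
  have "(\<Sum>x\<in>insert y A. (if x = y then u else v * c x) * x) = u * y + (\<Sum>x\<in>A. v * (c x * x))"
    using insert.hyps by (auto simp: mult.assoc intro!: sum.cong)
  also have "\<dots> = Gcd (insert y A)"
    using uv c by (simp add: sum_distrib_left[symmetric])
  finally show ?case by (rule exI[where x = "\<lambda>x. if x = y then u else v * c x"])
qed simp

text \<open>
  In a Bezout combination for \<open>n\<close> the coefficients of the elements other than \<open>m\<close> may be reduced
  modulo \<open>m\<close>.  The reduced part stays below a fixed bound, so for large \<open>n\<close> the remainder, a
  multiple of \<open>m\<close>, is nonnegative.
\<close>

lemma large_representable:
  fixes A :: "int set"
  assumes "finite A" "A \<subseteq> {0..m}" "m \<in> A" "m > 0" "Gcd A = 1" "n \<ge> m * (\<Sum>x\<in>A. x)"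
  shows "\<exists>k h. k \<in> reps A h n"
proof -
  obtain c where c: "(\<Sum>x\<in>A. c x * x) = 1"
    using Gcd_int_bezout[OF assms(1)] assms(5) by auto
  define S where "S = (\<Sum>x\<in>A - {m}. (n * c x mod m) * x)"
  have "S \<le> (\<Sum>x\<in>A - {m}. m * x)"
    unfolding S_def using assms(2,4)
    by (intro sum_mono mult_right_mono) (auto simp: less_imp_le)
  also have "\<dots> \<le> (\<Sum>x\<in>A. m * x)"
    using assms by (intro sum_mono2) auto
  finally have S_le: "S \<le> n"
    using assms(6) by (simp add: sum_distrib_left)
  have "n = n * (\<Sum>x\<in>A. c x * x)"
    by (simp add: c)
  also have "\<dots> = n * c m * m + (\<Sum>x\<in>A - {m}. n * c x * x)"
    using assms(1,3) by (simp add: sum.remove[of A m] algebra_simps sum_distrib_left)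
  finally have "n - S = n * c m * m + (\<Sum>x\<in>A - {m}. (n * c x - n * c x mod m) * x)"
    by (simp add: S_def left_diff_distrib sum_subtractf)
  moreover have "m dvd (n * c x - n * c x mod m) * x" for x
    by simp
  ultimately have "m dvd n - S"
    by (simp add: dvd_sum)
  then obtain q where q: "n - S = m * q" ..
  then have q0: "q \<ge> 0"
    using S_le assms(4) by (metis diff_ge_0_iff_ge zero_le_mult_iff not_less)
  define k where "k = (\<lambda>x\<in>A. nat (n * c x mod m))(m := nat q)"
  have "(\<Sum>x\<in>A - {m}. int ((\<lambda>x\<in>A. nat (n * c x mod m)) x) * x) = S"
    unfolding S_def using assms(4) by (intro sum.cong) auto
  then have "(\<Sum>a\<in>A. int (k a) * a) = n"
    unfolding k_def sum_weight_update(1)[OF assms(1,3)]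
    using q q0 by (simp add: mult.commute)
  moreover have "k \<in> A \<rightarrow>\<^sub>E UNIV"
    using assms(3) by (auto simp: k_def)
  ultimately show ?thesis
    by (auto simp: reps_def)
qed

text \<open>
  The equality \<open>m \<cdot> b = b \<cdot> m\<close> lets one trade \<open>m\<close> copies of \<open>b\<close> for \<open>b\<close> copies of \<open>m\<close> and
  \<open>m - b\<close> zeros.  With \<open>t\<close> such blocks appended, each choice of how many take the first form
  gives another representation, always with the same number of summands.
\<close>

lemma rep_count_exchange:
  fixes A :: "int set"
  assumes "finite A" "0 \<in> A" "b \<in> A" "m \<in> A" "0 < b" "b < m" "k \<in> reps A h n"
  shows "rep_count A (h + t * nat m) (n + int t * (b * m)) \<ge> t"
proof -
  define g where "g = (\<lambda>i x. if x \<in> A then k x + (if x = b then i * nat m else 0)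
      + (if x = m then (t - i) * nat b else 0) + (if x = 0 then (t - i) * nat (m - b) else 0)
      else undefined)"
  have "g i \<in> reps A (h + t * nat m) (n + int t * (b * m))" if "i < t" for i
  proof -
    have "(\<Sum>x\<in>A. g i x) = (\<Sum>x\<in>A. k x) + i * nat m + (t - i) * nat b + (t - i) * nat (m - b)"
      using assms by (simp add: g_def sum.distrib)
    also have "\<dots> = h + i * nat m + (t - i) * (nat b + nat (m - b))"
      using assms(7) by (simp add: reps_def algebra_simps)
    also have "nat b + nat (m - b) = nat m"
      using assms(5,6) by simp
    also have "h + i * nat m + (t - i) * nat m = h + t * nat m"
      using that add_mult_distrib[of i "t - i" "nat m"] by simp
    finally have cnt: "(\<Sum>x\<in>A. g i x) = h + t * nat m" .
    have "int (g i x) * x = int (k x) * x + (if x = b then int i * m * b else 0)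
        + (if x = m then int (t - i) * b * m else 0)" if "x \<in> A" for x
      using that assms(5,6) by (auto simp: g_def distrib_right)
    then have "(\<Sum>x\<in>A. int (g i x) * x) =
        (\<Sum>x\<in>A. int (k x) * x) + int i * m * b + int (t - i) * b * m"
      using assms by (simp add: sum.distrib)
    also have "\<dots> = n + int t * (b * m)"
      using that assms(7) by (simp add: reps_def of_nat_diff algebra_simps)
    finally show ?thesis
      using cnt by (auto simp: reps_def g_def PiE_iff extensional_def)
  qed
  then have "g ` {..<t} \<subseteq> reps A (h + t * nat m) (n + int t * (b * m))"
    by auto
  moreover have "inj_on g {..<t}"
  proof (rule inj_onI)
    fix i j assume "g i = g j"
    then have "g i b = g j b" by simp
    then show "i = j"
      using assms(3,5,6) by (simp add: g_def)
  qed
  ultimately show ?thesis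
    unfolding rep_count_eq
    by (metis card_image card_lessThan card_mono finite_reps[OF assms(1)])
qed

section \<open>Normalized sets\<close>

text \<open>
  Sets with minimum \<open>0\<close>, maximum \<open>m\<close> and least positive element \<open>b\<close>, described without an
  enumeration so that the same results apply to the reflected set, where \<open>m - a\<^sub>l\<close> takes the
  place of \<open>b\<close>.  The condition \<open>b < m\<close> provides the second positive element without which
  representations would be unique up to zeros.
\<close>

locale normalized_set =
  fixes A :: "int set" and m b :: int
  assumes finite: "finite A"
    and range: "A \<subseteq> {0..m}"
    and zero_mem: "0 \<in> A"
    and max_mem: "m \<in> A"
    and Gcd_1: "Gcd A = 1"
    and b_mem: "b \<in> A"
    and b_pos: "0 < b"
    and b_less: "b < m"
    and b_least: "\<And>x. x \<in> A \<Longrightarrow> x \<noteq> 0 \<Longrightarrow> b \<le> x"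
begin

lemma finite_exceptional:
  assumes "t \<ge> 1"
  shows "finite (exceptional t A)"
proof (rule finite_subset)
  let ?N = "int t * (b * m) + m * (\<Sum>x\<in>A. x)"
  show "exceptional t A \<subseteq> {0..<?N}"
  proof (rule subsetI, rule ccontr)
    fix n assume n: "n \<in> exceptional t A" and "n \<notin> {0..<?N}"
    then have "n - int t * (b * m) \<ge> m * (\<Sum>x\<in>A. x)"
      by (auto simp: exceptional_def)
    then obtain k h where "k \<in> reps A h (n - int t * (b * m))"
      using large_representable[OF finite range max_mem _ Gcd_1] b_pos b_less by fastforce
    from rep_count_exchange[OF finite zero_mem b_mem max_mem b_pos b_less this, of t]
    have "n \<in> fold_sumset t (h + t * nat m) A"
      using n by (simp add: fold_sumset_def exceptional_def)
    moreover have "t * nat m > 0"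
      using assms b_pos b_less by simp
    then have "h + t * nat m \<ge> 1"
      by linarith
    ultimately show False
      using n by (auto simp: exceptional_def representable_def)
  qed
qed simp

lemma Frob_nonneg:
  assumes "t \<ge> 1"
  shows "Frob t A \<ge> 0"
proof (cases "exceptional t A = {}")
  case False
  then have "Max (exceptional t A) \<in> exceptional t A"
    using finite_exceptional[OF assms] by simp
  then show ?thesis
    using False by (auto simp: Frob_def exceptional_def)
qed (simp add: Frob_def)

lemma representable_above_Frob:
  assumes "t \<ge> 1" "n > Frob t A"
  shows "n \<in> representable t A"
proof (rule ccontr)
  assume "n \<notin> representable t A"
  then have "n \<in> exceptional t A"
    using assms Frob_nonneg[OF assms(1)] by (simp add: exceptional_def)
  then have "n \<le> Frob t A"
    using finite_exceptional[OF assms(1)] by (auto simp: Frob_def)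
  with assms(2) show False by simp
qed

lemma saturation_length_pos:
  assumes "t \<ge> 1"
  shows "(Frob t A + m) div b \<ge> 1"
  using zdiv_mono1[of b "Frob t A + m" b] Frob_nonneg[OF assms] b_pos b_less by simp

text \<open>
  Each additional summand beyond \<open>(F + m) div b\<close> extends the reach by \<open>m\<close>: a number just outside
  the current range exceeds \<open>F + m\<close>, so it is still non-exceptional after one copy of \<open>m\<close> is
  removed.
\<close>

lemma rep_count_ge_below_step:
  assumes "t \<ge> 1" "n \<in> representable t A" "n \<le> Frob t A + (int j + 1) * m"
  shows "t \<le> rep_count A (nat ((Frob t A + m) div b) + j) n"
  using assms(2,3)
proof (induction j arbitrary: n)
  case 0
  then obtain H where "t \<le> rep_count A H n"
    by (auto simp: representable_def fold_sumset_def)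
  also have "\<dots> \<le> rep_count A (nat ((Frob t A + m) div b)) n"
    using 0 Frob_nonneg[OF assms(1)] b_pos b_less
    by (intro rep_count_saturates[OF finite zero_mem b_pos b_least]) auto
  finally show ?case by simp
next
  case (Suc j)
  show ?case
  proof (cases "n \<le> Frob t A + (int j + 1) * m")
    case True
    with Suc have "t \<le> rep_count A (nat ((Frob t A + m) div b) + j) n"
      by blast
    also have "\<dots> \<le> rep_count A (nat ((Frob t A + m) div b) + Suc j) n"
      by (intro rep_count_mono[OF finite zero_mem]) simp
    finally show ?thesis .
  next
    case False
    moreover have "int j * m \<ge> 0"
      using b_pos b_less by simp
    ultimately have "n - m > Frob t A"
      by (simp add: algebra_simps)
    moreover have "n - m \<le> Frob t A + (int j + 1) * m"
      using Suc.prems by (simp add: algebra_simps)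
    ultimately have "t \<le> rep_count A (nat ((Frob t A + m) div b) + j) (n - m)"
      using Suc.IH representable_above_Frob[OF assms(1)] by blast
    also have "\<dots> \<le> rep_count A (nat ((Frob t A + m) div b) + Suc j) n"
      using rep_count_append[OF finite max_mem, where j = 1 and n = "n - m"] by simp
    finally show ?thesis .
  qed
qed

lemma rep_count_ge_below:
  assumes "t \<ge> 1" "n \<in> representable t A" "(Frob t A + m) div b \<le> int h"
    "n \<le> Frob t A + (int h - (Frob t A + m) div b + 1) * m"
  shows "t \<le> rep_count A h n"
proof -
  let ?s = "(Frob t A + m) div b"
  have "?s \<ge> 0"
    using saturation_length_pos[OF assms(1)] by simp
  then have "nat ?s + nat (int h - ?s) = h" "int (nat (int h - ?s)) = int h - ?s"
    using assms(3) by linarith+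
  then show ?thesis
    using rep_count_ge_below_step[OF assms(1,2), of "nat (int h - ?s)"] assms(4) by simp
qed

end

lemma Gcd_reflect:
  fixes A :: "int set"
  assumes "0 \<in> A" "m \<in> A"
  shows "Gcd ((\<lambda>x. m - x) ` A) = Gcd A"
proof -
  have dvd: "Gcd B dvd Gcd ((\<lambda>x. m - x) ` B)" if "m \<in> B" for B :: "int set"
    using that by (intro Gcd_greatest) (auto intro: dvd_diff Gcd_dvd)
  have "m \<in> (\<lambda>x. m - x) ` A"
    using assms(1) by force
  then show ?thesis
    using dvd[OF assms(2)] dvd[of "(\<lambda>x. m - x) ` A"]
    by (intro zdvd_antisym_nonneg) (simp_all add: reflect_image_image)
qed

section \<open>The structure theorem\<close>

theorem theorem1p1:
  fixes l :: nat and a :: "nat \<Rightarrow> int" and A :: "int set" and m :: int and t h :: nat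
  assumes "strict_mono_on {0..l+1} a"
    and "a 0 = 0"
    and "a (l+1) = m"
    and "A = a ` {0..l+1}"
    and "Gcd A = 1"
    and "l + 2 \<ge> 4"
    and "t \<ge> 1"
    and "int h \<ge> \<lfloor>real_of_int (Frob t A + m) / real_of_int (a 1)\<rfloor>
               + \<lfloor>real_of_int (Frob t ((\<lambda>x. m - x) ` A) + m) / real_of_int (m - a l)\<rfloor>"
  shows "fold_sumset t h A =
           {0..int h * m} - (exceptional t A \<union>
             (\<lambda>x. int h * m - x) ` exceptional t ((\<lambda>x. m - x) ` A))"
proof -
  have less: "a i < a j" if "i < j" "j \<le> l + 1" for i j
    using assms(1) that by (auto simp: strict_mono_on_def)
  have le: "a i \<le> a j" if "i \<le> j" "j \<le> l + 1" for i j
    using less[of i j] that by (cases "i = j") auto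
  interpret N: normalized_set A m "a 1"
  proof
    show "finite A" "Gcd A = 1"
      using assms(4,5) by simp_all
    show "A \<subseteq> {0..m}"
      using le[of 0] le[of _ "l + 1"] assms(2-4) by auto
    show "0 \<in> A" "m \<in> A" "a 1 \<in> A"
      using assms(2-4) by (force intro: rev_image_eqI)+
    show "0 < a 1" "a 1 < m"
      using less[of 0 1] less[of 1 "l + 1"] assms(2,3,6) by auto
    show "a 1 \<le> x" if x: "x \<in> A" "x \<noteq> 0" for x
    proof -
      obtain i where i: "i \<le> l + 1" "x = a i"
        using x assms(4) by auto
      with x assms(2) have "i \<noteq> 0" by metis
      then show ?thesis using le[of 1 i] i by simp
    qed
  qed
  let ?B = "(\<lambda>x. m - x) ` A"
  interpret R: normalized_set ?B m "m - a l"
  proof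
    show "finite ?B" "Gcd ?B = 1"
      using N.finite N.Gcd_1 Gcd_reflect[OF N.zero_mem N.max_mem] by simp_all
    show "?B \<subseteq> {0..m}"
      using N.range by auto
    show "0 \<in> ?B" "m \<in> ?B"
      using N.zero_mem N.max_mem by force+
    show "m - a l \<in> ?B"
      using assms(4) by auto
    show "0 < m - a l" "m - a l < m"
      using less[of l "l + 1"] less[of 0 l] assms(2,3,6) by auto
    show "m - a l \<le> x" if x: "x \<in> ?B" "x \<noteq> 0" for x
    proof -
      obtain i where i: "i \<le> l + 1" "x = m - a i"
        using x assms(4) by auto
      with x assms(3) have "i \<noteq> l + 1" by auto
      then show ?thesis using le[of i l] i by simp
    qed
  qed
  let ?s = "(Frob t A + m) div a 1" and ?s' = "(Frob t ?B + m) div (m - a l)"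
  have h: "int h \<ge> ?s + ?s'"
    using assms(8) by (simp only: floor_divide_of_int_eq)
  have s: "?s \<ge> 1" "?s' \<ge> 1"
    using N.saturation_length_pos[OF assms(7)] R.saturation_length_pos[OF assms(7)] .
  have h1: "h \<ge> 1"
    using h s by linarith
  have m: "m > 0"
    using N.b_pos N.b_less by simp
  have reflect: "rep_count ?B h (int h * m - n) = rep_count A h n" for n
    by (rule rep_count_reflect[OF N.finite])
  show ?thesis
  proof (rule set_eqI, rule iffI)
    fix n assume n: "n \<in> fold_sumset t h A"
    then have "0 \<le> n" "n \<le> int h * m"
      using rep_count_pos_bounds[OF N.range, of h n] assms(7) by (auto simp: fold_sumset_def)
    moreover have "n \<in> representable t A"
      using n h1 by (auto simp: representable_def)
    moreover have "int h * m - n \<in> representable t ?B"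
      using n h1 \<open>n \<le> int h * m\<close> reflect[of n]
      by (auto simp: representable_def fold_sumset_def intro!: bexI[of _ h])
    ultimately show "n \<in> {0..int h * m} - (exceptional t A \<union>
             (\<lambda>x. int h * m - x) ` exceptional t ?B)"
      by (auto simp: exceptional_def)
  next
    fix n assume n: "n \<in> {0..int h * m} - (exceptional t A \<union>
             (\<lambda>x. int h * m - x) ` exceptional t ?B)"
    then have n_rep: "n \<in> representable t A"
      by (auto simp: exceptional_def)
    have "int h * m - n \<notin> exceptional t ?B"
    proof
      assume "int h * m - n \<in> exceptional t ?B"
      then have "int h * m - (int h * m - n) \<in> (\<lambda>x. int h * m - x) ` exceptional t ?B"
        by (rule imageI)
      with n show False by simp
    qed
    then have n'_rep: "int h * m - n \<in> representable t ?B"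
      using n by (auto simp: exceptional_def)
    have "t \<le> rep_count A h n"
    proof (cases "n \<le> Frob t A + (int h - ?s + 1) * m")
      case True
      then show ?thesis
        using N.rep_count_ge_below[OF assms(7) n_rep] h s by simp
    next
      case False
      \<comment> \<open>Both \<open>n\<close> and \<open>h m - n\<close> beyond their ranges would force \<open>h m > (h + 2) m\<close>.\<close>
      have "(int h + 2) * m \<le> (2 * int h - ?s - ?s' + 2) * m"
        using h m by (intro mult_right_mono) auto
      then have "int h * m - n \<le> Frob t ?B + (int h - ?s' + 1) * m"
        using False m N.Frob_nonneg[OF assms(7)] R.Frob_nonneg[OF assms(7)]
        by (simp add: algebra_simps)
      then show ?thesis
        using R.rep_count_ge_below[OF assms(7) n'_rep, of h] h s reflect[of n] by simp
    qed
    then show "n \<in> fold_sumset t h A"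
      using n by (simp add: fold_sumset_def)
  qed
qed

end
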